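(* Let $n\geq 3$ be an integer and let $D_n=\{(i,j):1\leq i<j\leq n\}$. Every total preorder on $D_n$ is induced by a collection $P=(p_1,\dots,p_n)$ of $n$ pairwise distinct points in $\mathbb{R}^{n-1}$.
   Context: A total preorder is a reflexive, transitive relation in which any two elements are comparable. A collection $P=(p_1,\dots,p_n)$ of points in $\mathbb{R}^d$ (Euclidean norm) induces the total preorder on $D_n$ given by: $(i_1,i_2)\leq(j_1,j_2)$ if and only if $\|p_{i_1}-p_{i_2}\|\leq\|p_{j_1}-p_{j_2}\|$. A given total preorder on $D_n$ is induced by $P$ if it coincides with this relation. *)

theory Defs
  imports "HOL-Analysis.Analysis"
begin

definition index_pairs :: "nat \<Rightarrow> (nat \<times> nat) set" where
  "index_pairs n = {(i, j). 1 \<le> i \<and> i < j \<and> j \<le> n}"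

(* preorder_on already contains the requirement r \<subseteq> A \<times> A. *)
definition total_preorder_on :: "'a set \<Rightarrow> 'a rel \<Rightarrow> bool" where
  "total_preorder_on A r \<longleftrightarrow> preorder_on A r \<and> total_on A r"

(* A collection (p_1, ..., p_n) is a function on nat of which only the values at 1, ..., n
   matter.  The pair (a, b) is in the relation iff a \<le> b in the induced preorder. *)
definition induced_preorder :: "nat \<Rightarrow> (nat \<Rightarrow> 'a::real_normed_vector) \<Rightarrow> (nat \<times> nat) rel" where
  "induced_preorder n p =
    {((i1, i2), (j1, j2)).
       (i1, i2) \<in> index_pairs n \<and> (j1, j2) \<in> index_pairs n \<and>
       norm (p i1 - p i2) \<le> norm (p j1 - p j2)}"

end

theory Submission
  imports Defs
begin

text \<open>
  The squared distances between \<^term>\<open>n\<close> points of equal norm are determined by the inner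
  products of distinct points: if \<open>\<parallel>x i\<parallel>\<^sup>2 = c\<close> for all \<open>i\<close>, then \<open>\<parallel>x i - x j\<parallel>\<^sup>2 = 2 * (c - x i \<bullet> x j)\<close>.
  So it suffices to prescribe these inner products as a function \<open>s\<close> of the pair that reverses
  the given preorder; the number of pairs above a given pair is such a function.

  Any non-negative symmetric \<open>s\<close> can be prescribed, provided that \<open>c\<close> is large: the Gram matrix
  with diagonal \<open>c\<close> and off-diagonal entries \<open>s i j\<close> is then diagonally dominant, hence
  positive semidefinite.  The decomposition of such a matrix into rank-one terms \<open>v v\<^sup>T\<close>, in which
  \<open>v\<close> is a multiple of \<open>e\<^sub>i + e\<^sub>j\<close> or of \<open>e\<^sub>i\<close>, gives the points explicitly, with one
  coordinate for each term (\<open>nonneg_gram_realization\<close>).  These points live in a space of far too large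
  dimension, but \<^term>\<open>n\<close> points always lie in an affine subspace of dimension at most
  \<^term>\<open>n - 1\<close>, which embeds isometrically into the target (\<open>points_isometric_embedding\<close>).
\<close>

text \<open>If \<open>x\<close> is not below \<open>y\<close>, then by totality \<open>y\<close> is below \<open>x\<close>, and \<open>y\<close> itself witnesses that
  strictly more elements lie above \<open>y\<close> than above \<open>x\<close>.\<close>

lemma total_preorder_iff_card_above:
  assumes R: "total_preorder_on A R" and fin: "finite A" and x: "x \<in> A" and y: "y \<in> A"
  shows "(x, y) \<in> R \<longleftrightarrow> card (R `` {y}) \<le> card (R `` {x})"
proof
  have tr: "trans R" and re: "refl_on A R" and sub: "R \<subseteq> A \<times> A" and tot: "total_on A R"
    using R by (auto simp: total_preorder_on_def preorder_on_def)
  have finite_above: "finite (R `` {z})" for z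
    using sub by (intro finite_subset[OF _ fin]) auto
  have above_mono: "R `` {b} \<subseteq> R `` {a}" if "(a, b) \<in> R" for a b
    using that tr by (auto dest: transD)
  show "card (R `` {y}) \<le> card (R `` {x})" if "(x, y) \<in> R"
    using above_mono[OF that] finite_above by (rule card_mono[rotated])
  show "(x, y) \<in> R" if le: "card (R `` {y}) \<le> card (R `` {x})"
  proof (rule ccontr)
    assume not_below: "(x, y) \<notin> R"
    have yy: "(y, y) \<in> R" using re y by (rule refl_onD)
    have "(y, x) \<in> R"
      using tot x y not_below yy by (auto simp: total_on_def)
    then have "R `` {x} \<subset> R `` {y}"
      using above_mono[of y x] not_below yy by blast
    then have "card (R `` {x}) < card (R `` {y})"
      using finite_above by (simp add: psubset_card_mono)
    with le show False by simp
  qed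
qed

text \<open>
  The coordinates are indexed by pairs, and only the coordinates in which \<open>i\<close> occurs are non-zero
  at the point \<open>x i\<close>.  Two distinct points \<open>x i\<close> and \<open>x j\<close> therefore interact only in the
  coordinates \<open>(i, j)\<close> and \<open>(j, i)\<close>, which fixes their inner product, while the private
  coordinate \<open>(i, i)\<close> is free to adjust the norm of \<open>x i\<close>.
\<close>

lemma nonneg_gram_realization:
  fixes s :: "'k::finite \<Rightarrow> 'k \<Rightarrow> real"
  assumes nonneg: "\<And>i j. 0 \<le> s i j" and sym: "\<And>i j. s i j = s j i"
    and dom: "\<And>i. (\<Sum>j\<in>-{i}. s i j) \<le> c"
  shows "\<exists>x :: 'k \<Rightarrow> real ^ ('k \<times> 'k).
           \<forall>i j. x i \<bullet> x j = (if i = j then c else s i j)"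
proof -
  \<comment> \<open>The off-diagonal weights are halved because the pairs \<open>(i, j)\<close> and \<open>(j, i)\<close> both contribute.\<close>
  define u where "u q = (if fst q = snd q then c - (\<Sum>b\<in>-{fst q}. s (fst q) b)
                         else s (fst q) (snd q) / 2)" for q :: "'k \<times> 'k"
  have u_nonneg: "0 \<le> u q" for q
    using nonneg dom by (auto simp: u_def)
  define x :: "'k \<Rightarrow> real ^ ('k \<times> 'k)"
    where "x i = (\<chi> q. if i = fst q \<or> i = snd q then sqrt (u q) else 0)" for i
  have inner_x: "x i \<bullet> x j =
      (\<Sum>q | (i = fst q \<or> i = snd q) \<and> (j = fst q \<or> j = snd q). u q)" for i j
  proof -
    have "x i \<bullet> x j = (\<Sum>q\<in>UNIV. if (i = fst q \<or> i = snd q) \<and> (j = fst q \<or> j = snd q)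
                                  then u q else 0)"
      unfolding inner_vec_def x_def using u_nonneg by (intro sum.cong) auto
    also have "\<dots> = (\<Sum>q | (i = fst q \<or> i = snd q) \<and> (j = fst q \<or> j = snd q). u q)"
      by (simp add: sum.If_cases)
    finally show ?thesis .
  qed
  have offdiag: "x i \<bullet> x j = s i j" if "i \<noteq> j" for i j
  proof -
    have "{q. (i = fst q \<or> i = snd q) \<and> (j = fst q \<or> j = snd q)} = {(i, j), (j, i)}"
      using that by auto
    then show ?thesis
      using that sym[of i j] by (simp add: inner_x u_def)
  qed
  have diag: "x i \<bullet> x i = c" for i
  proof -
    have "{q. (i = fst q \<or> i = snd q) \<and> (i = fst q \<or> i = snd q)} =
        insert (i, i) (Pair i ` (-{i}) \<union> (\<lambda>b. (b, i)) ` (-{i}))"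
      by (auto simp: image_iff)
    then have "x i \<bullet> x i = (\<Sum>q\<in>insert (i, i) (Pair i ` (-{i}) \<union> (\<lambda>b. (b, i)) ` (-{i})). u q)"
      by (simp only: inner_x)
    also have "\<dots> = u (i, i) + (\<Sum>q\<in>Pair i ` (-{i}) \<union> (\<lambda>b. (b, i)) ` (-{i}). u q)"
      by (subst sum.insert) auto
    also have "\<dots> = u (i, i) + ((\<Sum>q\<in>Pair i ` (-{i}). u q) + (\<Sum>q\<in>(\<lambda>b. (b, i)) ` (-{i}). u q))"
      by (subst sum.union_disjoint) auto
    also have "\<dots> = u (i, i) + ((\<Sum>b\<in>-{i}. u (i, b)) + (\<Sum>b\<in>-{i}. u (b, i)))"
      by (simp add: sum.reindex inj_on_def)
    also have "(\<Sum>b\<in>-{i}. u (i, b)) = (\<Sum>b\<in>-{i}. s i b / 2)"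
      by (intro sum.cong) (auto simp: u_def)
    also have "(\<Sum>b\<in>-{i}. u (b, i)) = (\<Sum>b\<in>-{i}. s i b / 2)"
      by (intro sum.cong) (auto simp: u_def sym[of i])
    finally show ?thesis
      by (simp add: u_def sum_divide_distrib[symmetric])
  qed
  show ?thesis
    using offdiag diag by (intro exI[of _ x]) auto
qed

text \<open>Translating one of the points to the origin leaves one vector fewer to span the subspace that
  has to be embedded.\<close>

lemma points_isometric_embedding:
  fixes X :: "'a::euclidean_space set"
  assumes fin: "finite X" and card: "card X \<le> DIM('b::euclidean_space) + 1"
  shows "\<exists>f :: 'a \<Rightarrow> 'b. \<forall>y\<in>X. \<forall>z\<in>X. norm (f y - f z) = norm (y - z)"
proof (cases "X = {}")
  case False
  then obtain a where a: "a \<in> X" by blast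
  define S where "S = span ((\<lambda>y. y - a) ` (X - {a}))"
  have "dim S \<le> card ((\<lambda>y. y - a) ` (X - {a}))"
    unfolding S_def using fin by (simp add: dim_le_card')
  also have "\<dots> \<le> card (X - {a})"
    using fin by (intro card_image_le) simp
  also have "\<dots> \<le> dim (UNIV :: 'b set)"
    using card a fin by simp
  finally obtain g :: "'a \<Rightarrow> 'b"
    where g: "linear g" "\<And>v. v \<in> S \<Longrightarrow> norm (g v) = norm v"
    using isometry_subset_subspace[of S "UNIV :: 'b set"] unfolding S_def
    by (metis subspace_UNIV subspace_span)
  have in_S: "y - a \<in> S" if "y \<in> X" for y
    using that unfolding S_def by (cases "y = a") (auto intro: span_base span_zero)
  have "norm (g (y - a) - g (z - a)) = norm (y - z)" if "y \<in> X" "z \<in> X" for y z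
  proof -
    have diff: "(y - a) - (z - a) = y - z" by simp
    have "y - z \<in> S"
      using in_S[OF that(1)] in_S[OF that(2)] span_diff unfolding S_def by (metis diff)
    then show ?thesis
      using g(2) linear_diff[OF g(1), of "y - a" "z - a"] unfolding diff by metis
  qed
  then show ?thesis
    by (intro exI[of _ "\<lambda>y. g (y - a)"]) blast
qed simp

theorem proposition8:
  fixes n :: nat and R :: "(nat \<times> nat) rel"
  assumes "n \<ge> 3"
    and "CARD('d::finite) = n - 1"
    and "total_preorder_on (index_pairs n) R"
  shows "\<exists>p :: nat \<Rightarrow> real ^ 'd. inj_on p {1..n} \<and> induced_preorder n p = R"
proof -
  have card_option: "CARD('d option) = n"
    using assms(1,2) by (simp add: card_UNIV_option)
  then obtain h :: "nat \<Rightarrow> 'd option" where h: "bij_betw h {1..n} UNIV"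
    using finite_same_card_bij[of "{1..n}" "UNIV :: 'd option set"] by auto
  define k where "k = inv_into {1..n} h"
  have k_h: "k (h i) = i" if "i \<in> {1..n}" for i
    using h that by (simp add: k_def bij_betw_inv_into_left)
  have h_eq_iff: "h i = h j \<longleftrightarrow> i = j" if "i \<in> {1..n}" "j \<in> {1..n}" for i j
    using k_h that by metis

  define s :: "'d option \<Rightarrow> 'd option \<Rightarrow> real"
    where "s v w = card (R `` {(min (k v) (k w), max (k v) (k w))})" for v w
  have nonneg: "0 \<le> s v w" for v w
    by (simp add: s_def)
  have sym: "s v w = s w v" for v w
    by (simp add: s_def min.commute max.commute)
  \<comment> \<open>One more than diagonal dominance asks for: this keeps distinct points apart.\<close>
  define c where "c = 1 + (\<Sum>v\<in>UNIV. \<Sum>w\<in>UNIV. s v w)"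
  have row_le: "(\<Sum>w\<in>W. s v w) < c" for v W
  proof -
    have "(\<Sum>w\<in>W. s v w) \<le> (\<Sum>w\<in>UNIV. s v w)"
      by (intro sum_mono2) (auto simp: nonneg)
    also have "\<dots> \<le> (\<Sum>v\<in>UNIV. \<Sum>w\<in>UNIV. s v w)"
      by (intro member_le_sum) (auto simp: nonneg intro: sum_nonneg)
    finally show ?thesis by (simp add: c_def)
  qed
  have s_less: "s v w < c" for v w
    using row_le[of v "{w}"] by simp
  obtain x :: "'d option \<Rightarrow> real ^ ('d option \<times> 'd option)"
    where x: "\<And>v w. x v \<bullet> x w = (if v = w then c else s v w)"
    using nonneg_gram_realization[of s c] nonneg sym less_imp_le[OF row_le] by metis
  have "card (range x) \<le> DIM(real ^ 'd) + 1"
    using card_image_le[of "UNIV :: 'd option set" x] card_option assms(1,2) by simp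
  then obtain f :: "_ \<Rightarrow> real ^ 'd"
    where f: "\<And>v w. norm (f (x v) - f (x w)) = norm (x v - x w)"
    using points_isometric_embedding[of "range x", where 'b = "real ^ 'd"] by auto
  define p where "p i = f (x (h i))" for i
  have dist: "norm (p i - p j) = sqrt (2 * (c - card (R `` {(i, j)})))"
    if "(i, j) \<in> index_pairs n" for i j
  proof -
    have ij: "i \<in> {1..n}" "j \<in> {1..n}" "i < j"
      using that by (auto simp: index_pairs_def)
    have "(norm (x (h i) - x (h j)))\<^sup>2 = 2 * (c - s (h i) (h j))"
      using ij h_eq_iff[OF ij(1,2)] sym[of "h i" "h j"]
      by (simp add: power2_norm_eq_inner inner_diff x)
    moreover have "s (h i) (h j) = card (R `` {(i, j)})"
      using ij by (simp add: s_def k_h)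
    ultimately have "(norm (p i - p j))\<^sup>2 = 2 * (c - card (R `` {(i, j)}))"
      by (simp add: p_def f)
    then show ?thesis by (metis norm_ge_zero real_sqrt_unique)
  qed
  have "finite (index_pairs n)"
    by (rule finite_subset[of _ "{1..n} \<times> {1..n}"]) (auto simp: index_pairs_def)
  then have "(a, b) \<in> R \<longleftrightarrow> norm (p (fst a) - p (snd a)) \<le> norm (p (fst b) - p (snd b))"
    if "a \<in> index_pairs n" "b \<in> index_pairs n" for a b
    using total_preorder_iff_card_above[OF assms(3) _ that] that
    by (simp add: dist)
  moreover have "R \<subseteq> index_pairs n \<times> index_pairs n"
    using assms(3) by (simp add: total_preorder_on_def preorder_on_def)
  ultimately have "induced_preorder n p = R"
    unfolding induced_preorder_def by fastforce
  moreover have "inj_on p {1..n}"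
  proof (rule inj_onI)
    fix i j assume ij: "i \<in> {1..n}" "j \<in> {1..n}" "p i = p j"
    have "x (h i) = x (h j)"
      using f[of "h i" "h j"] ij(3) by (simp add: p_def)
    then have "x (h i) \<bullet> x (h j) = c"
      by (simp add: x)
    then have "h i = h j"
      using x[of "h i" "h j"] s_less[of "h i" "h j"] by (auto split: if_splits)
    then show "i = j" using h_eq_iff ij by blast
  qed
  ultimately show ?thesis by blast
qed

end
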